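(* A topological space $X$ is 0-semilocally simply connected if and only if each path component of $X$ is open in $X$.
   Context: For a space $X$, $\pi_0^{top}(X)$ is the set of path components of $X$ with the quotient topology from $X\to\pi_0(X)$. A space $X$ is 0-semilocally simply connected if for each $x\in X$ there is an open neighborhood $U$ of $x$ such that the inclusion $i:U\to X$ induces a constant map $\pi_0(i):\pi_0^{top}(U)\to\pi_0^{top}(X)$. *)

theory Defs
  imports "HOL-Analysis.Analysis"
begin

definition pi0_top :: "'a topology \<Rightarrow> 'a set topology" where
  "pi0_top X = topology (\<lambda>W. W \<subseteq> path_components_of X \<and>
     openin X {x \<in> topspace X. path_component_of_set X x \<in> W})"

lemma openin_pi0_top:
  "openin (pi0_top X) W \<longleftrightarrow> W \<subseteq> path_components_of X \<and>
     openin X {x \<in> topspace X. path_component_of_set X x \<in> W}"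
proof -
  let ?q = "path_component_of_set X"
  have "istopology (\<lambda>W. W \<subseteq> path_components_of X \<and> openin X {x \<in> topspace X. ?q x \<in> W})"
    unfolding istopology_def
  proof (intro conjI allI impI)
    fix S T
    assume S: "S \<subseteq> path_components_of X \<and> openin X {x \<in> topspace X. ?q x \<in> S}"
      and T: "T \<subseteq> path_components_of X \<and> openin X {x \<in> topspace X. ?q x \<in> T}"
    show "S \<inter> T \<subseteq> path_components_of X" using S by blast
    have "{x \<in> topspace X. ?q x \<in> S \<inter> T}
        = {x \<in> topspace X. ?q x \<in> S} \<inter> {x \<in> topspace X. ?q x \<in> T}"
      by blast
    then show "openin X {x \<in> topspace X. ?q x \<in> S \<inter> T}"
      using S T by auto
  next
    fix K
    assume K: "\<forall>W\<in>K. W \<subseteq> path_components_of X \<and> openin X {x \<in> topspace X. ?q x \<in> W}"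
    show "\<Union>K \<subseteq> path_components_of X" using K by blast
    have "{x \<in> topspace X. ?q x \<in> \<Union>K} = (\<Union>W\<in>K. {x \<in> topspace X. ?q x \<in> W})"
      by blast
    then show "openin X {x \<in> topspace X. ?q x \<in> \<Union>K}"
      using K by auto
  qed
  then show ?thesis
    by (simp add: pi0_top_def topology_inverse')
qed

lemma topspace_pi0_top [simp]: "topspace (pi0_top X) = path_components_of X"
proof
  show "topspace (pi0_top X) \<subseteq> path_components_of X"
    by (meson openin_pi0_top openin_topspace)
  have "{x \<in> topspace X. path_component_of_set X x \<in> path_components_of X} = topspace X"
    by (auto simp: path_components_of_def)
  then show "path_components_of X \<subseteq> topspace (pi0_top X)"
    by (intro openin_subset) (simp add: openin_pi0_top)
qed

lemma quotient_map_pi0_top: "quotient_map X (pi0_top X) (path_component_of_set X)"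
  unfolding quotient_map_def
  by (auto simp: openin_pi0_top path_components_of_def)

(* Meaningful for continuous f and C a path component of the domain: then exactly one
   path component of Y contains f ` C (see pi0_map_path_component). *)
definition pi0_map :: "'b topology \<Rightarrow> ('a \<Rightarrow> 'b) \<Rightarrow> 'a set \<Rightarrow> 'b set" where
  "pi0_map Y f C = (THE D. D \<in> path_components_of Y \<and> f ` C \<subseteq> D)"

lemma pi0_map_path_component:
  assumes f: "continuous_map X Y f" and x: "x \<in> topspace X"
  shows "pi0_map Y f (path_component_of_set X x) = path_component_of_set Y (f x)"
  unfolding pi0_map_def
proof (rule the_equality, intro conjI)
  have fx: "f x \<in> topspace Y"
    using f x by (auto simp: continuous_map_def)
  show "path_component_of_set Y (f x) \<in> path_components_of Y"
    using fx by (auto simp: path_components_of_def)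
  show "f ` path_component_of_set X x \<subseteq> path_component_of_set Y (f x)"
  proof (clarsimp simp: path_component_of_def)
    fix g assume "pathin X g" "x = g 0"
    then show "\<exists>h. pathin Y h \<and> h 0 = f (g 0) \<and> h 1 = f (g 1)"
      using f by (intro exI[of _ "f \<circ> g"]) (auto simp: pathin_def intro: continuous_map_compose)
  qed
next
  fix D assume D: "D \<in> path_components_of Y \<and> f ` path_component_of_set X x \<subseteq> D"
  then obtain y where y: "D = path_component_of_set Y y"
    by (auto simp: path_components_of_def)
  have "x \<in> path_component_of_set X x"
    using x by (simp add: path_component_of_refl)
  then have "path_component_of Y y (f x)"
    using D y by auto
  then show "D = path_component_of_set Y (f x)"
    by (metis path_component_of_equiv y)
qed

lemma continuous_map_pi0_map:
  assumes "continuous_map X Y f"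
  shows "continuous_map (pi0_top X) (pi0_top Y) (pi0_map Y f)"
proof (rule continuous_compose_quotient_map[OF quotient_map_pi0_top])
  have "continuous_map X (pi0_top Y) (path_component_of_set Y \<circ> f)"
    using assms continuous_map_compose quotient_imp_continuous_map quotient_map_pi0_top by blast
  then show "continuous_map X (pi0_top Y) (pi0_map Y f \<circ> path_component_of_set X)"
    by (rule continuous_map_eq) (simp add: pi0_map_path_component[OF assms])
qed

(* The inclusion U -> X is the identity function regarded as a map from the subspace U. *)
definition semilocally_simply_connected_0 :: "'a topology \<Rightarrow> bool" where
  "semilocally_simply_connected_0 X \<longleftrightarrow>
     (\<forall>x \<in> topspace X. \<exists>U. openin X U \<and> x \<in> U \<and>
        pi0_map X (\<lambda>u. u) constant_on topspace (pi0_top (subtopology X U)))"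

end

theory Submission
  imports Defs
begin

text \<open>
  The inclusion of a subspace \<open>U\<close> sends the path component of \<open>u\<close> in \<open>U\<close> to the path component
  of \<open>u\<close> in \<open>X\<close>, so it is constant on path components iff \<open>U\<close> lies in a single path component
  of \<open>X\<close>. A witness at \<open>x\<close> is thus an open neighbourhood of \<open>x\<close> inside the path component of \<open>x\<close>;
  conversely an open path component is itself such a witness.
\<close>

lemma pi0_map_inclusion_constant_on_iff:
  assumes "U \<subseteq> topspace X" "x \<in> U"
  shows "pi0_map X (\<lambda>u. u) constant_on topspace (pi0_top (subtopology X U)) \<longleftrightarrow>
         U \<subseteq> path_component_of_set X x"
proof -
  have top: "topspace X \<inter> U = U"
    using assms by auto
  have pi0: "pi0_map X (\<lambda>u. u) (path_component_of_set (subtopology X U) u) = path_component_of_set X u"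
    if "u \<in> U" for u
    using that top by (intro pi0_map_path_component) auto
  have "pi0_map X (\<lambda>u. u) constant_on topspace (pi0_top (subtopology X U)) \<longleftrightarrow>
        (\<exists>D. \<forall>u\<in>U. path_component_of_set X u = D)"
    by (simp add: constant_on_def path_components_of_def top pi0)
  \<comment> \<open>Since \<open>x\<close> lies in \<open>U\<close>, the common value
    \<open>D\<close> can only be the path component of \<open>x\<close>.\<close>
  also have "\<dots> \<longleftrightarrow> (\<forall>u\<in>U. path_component_of_set X x = path_component_of_set X u)"
    using assms(2) by metis
  also have "\<dots> \<longleftrightarrow> (\<forall>u\<in>U. path_component_of X x u)"
  proof (intro ball_cong refl)
    fix u assume "u \<in> U"
    \<comment> \<open>Points outside the space all have the empty set as component, so equal
      components yield a path only for points of \<open>topspace X\<close>.\<close>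
    with assms have "x \<in> topspace X" "u \<in> topspace X"
      by auto
    then show "path_component_of_set X x = path_component_of_set X u \<longleftrightarrow> path_component_of X x u"
      by (metis Collect_inj path_component_of_eq)
  qed
  also have "\<dots> \<longleftrightarrow> U \<subseteq> path_component_of_set X x"
    by blast
  finally show ?thesis .
qed

theorem proposition5p2:
  fixes X :: "'a topology"
  shows "semilocally_simply_connected_0 X \<longleftrightarrow> (\<forall>C \<in> path_components_of X. openin X C)"
proof -
  have "openin X U \<and> x \<in> U \<and>
          pi0_map X (\<lambda>u. u) constant_on topspace (pi0_top (subtopology X U)) \<longleftrightarrow>
        openin X U \<and> x \<in> U \<and> U \<subseteq> path_component_of_set X x" for x U
    \<comment> \<open>\<open>conj_cong\<close> makes openness of \<open>U\<close> and membership of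
      \<open>x\<close> available when the last conjuncts are compared.\<close>
    using pi0_map_inclusion_constant_on_iff[OF openin_subset] by (intro conj_cong) simp_all
  then have "semilocally_simply_connected_0 X \<longleftrightarrow>
        (\<forall>x\<in>topspace X. \<exists>U. openin X U \<and> x \<in> U \<and> U \<subseteq> path_component_of_set X x)"
    by (simp only: semilocally_simply_connected_0_def)
  also have "\<dots> \<longleftrightarrow> (\<forall>x\<in>topspace X. openin X (path_component_of_set X x))"
  proof (intro iffI ballI)
    fix x
    assume nbhd: "\<forall>x\<in>topspace X. \<exists>U. openin X U \<and> x \<in> U \<and> U \<subseteq> path_component_of_set X x"
    have "\<exists>U. openin X U \<and> y \<in> U \<and> U \<subseteq> path_component_of_set X x"
      if "y \<in> path_component_of_set X x" for y
    proof -
      have "y \<in> topspace X" "path_component_of_set X y = path_component_of_set X x"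
        using that by (metis mem_Collect_eq path_component_of_equiv)+
      \<comment> \<open>The neighbourhood is the one given at \<open>y\<close>, not at
        \<open>x\<close>; it lies in the component of \<open>y\<close>, which is also that of
        \<open>x\<close>.\<close>
      with nbhd show ?thesis by metis
    qed
    then show "openin X (path_component_of_set X x)"
      by (subst openin_subopen) blast
  next
    fix x
    assume "\<forall>x\<in>topspace X. openin X (path_component_of_set X x)" "x \<in> topspace X"
    then show "\<exists>U. openin X U \<and> x \<in> U \<and> U \<subseteq> path_component_of_set X x"
      by (metis mem_Collect_eq path_component_of_refl subset_refl)
  qed
  also have "\<dots> \<longleftrightarrow> (\<forall>C\<in>path_components_of X. openin X C)"
    by (simp add: path_components_of_def)
  finally show ?thesis .
qed

end
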